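(* Let $R$ be a Bézout domain. Every matrix $T\in\mathbb{M}_3(R)$ with $T^2=0_3$ is similar to $rE_{13}$ for some $r\in R$; that is, there exist $r\in R$ and an invertible matrix $U\in\mathbb{M}_3(R)$ such that $U^{-1}TU=rE_{13}$.
   Context: An integral domain is a GCD domain if every pair $a,b$ of nonzero elements has a greatest common divisor $\gcd(a,b)$; it is a Bézout domain if moreover $\gcd(a,b)$ is a linear combination of $a$ and $b$ (with coefficients in the domain). $\mathbb{M}_3(R)$ is the ring of $3\times 3$ matrices over $R$, $0_3$ is the zero $3\times 3$ matrix, and $E_{13}$ is the $3\times 3$ matrix whose $(1,3)$ entry is $1$ and whose other entries are all $0$. *)

theory Defs
  imports "HOL-Analysis.Cartesian_Space"
begin

text \<open>
  In an abstract integral domain greatest common divisors are determined only up to a unit, so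
  ``being a greatest common divisor'' is a relation. (The class \<^class>\<open>semiring_gcd\<close> would
  instead fix a normalised choice of greatest common divisors as part of the structure.)
\<close>

definition (in comm_semiring_1) is_gcd_of :: "'a \<Rightarrow> 'a \<Rightarrow> 'a \<Rightarrow> bool" where
  "is_gcd_of d a b \<longleftrightarrow> d dvd a \<and> d dvd b \<and> (\<forall>c. c dvd a \<longrightarrow> c dvd b \<longrightarrow> c dvd d)"

class gcd_domain = idom +
  assumes ex_gcd: "a \<noteq> 0 \<Longrightarrow> b \<noteq> 0 \<Longrightarrow> \<exists>d. is_gcd_of d a b"

class bezout_domain = gcd_domain +
  assumes gcd_lincomb: "a \<noteq> 0 \<Longrightarrow> b \<noteq> 0 \<Longrightarrow> is_gcd_of d a b \<Longrightarrow> \<exists>x y. d = x * a + y * b"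

text \<open>
  The index type \<^typ>\<open>3\<close> consists of the distinct elements \<open>1\<close>, \<open>2\<close> and \<open>3\<close> (with
  \<open>3 = 0\<close>); in \<open>A $ i $ j\<close> the first index is the row.
\<close>

definition E13 :: "'a::zero_neq_one ^ 3 ^ 3" where
  "E13 = (\<chi> i j. if i = 1 \<and> j = 3 then 1 else 0)"

end

theory Submission
  imports Defs
begin

text \<open>
  Over a Bezout domain every pair (a, b) is carried to (g, 0) by a matrix of determinant 1.
  A nonzero column c of T lies in the kernel of T, since T T = 0; moving c to a multiple of the first
  basis vector therefore makes the first column of a conjugate of T vanish. The same argument with the
  second column leaves a strictly upper triangular matrix, whose only possibly nonzero entries are in
  the third column or in the first row; one more such transformation reduces it to a single entry.
\<close>

text \<open>Dividing \<open>a = d * a'\<close> and \<open>b = d * b'\<close> by a gcd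
  \<open>d\<close> turns the Bezout relation into \<open>x * a' + y * b' = 1\<close>. The row
  \<open>(- b', a')\<close> annihilates \<open>(a, b)\<close> and completes \<open>(x, y)\<close> to
  determinant 1.\<close>

lemma bezout_unimodular:
  fixes a b :: "'a::bezout_domain"
  obtains p q s t g where "p * t - q * s = 1" "p * a + q * b = g" "s * a + t * b = 0"
proof (cases "a = 0 \<or> b = 0")
  case True
  then show ?thesis
    \<comment> \<open>The gcd axioms speak only of nonzero elements. The identity serves for
      \<open>b = 0\<close>, a quarter turn for \<open>a = 0\<close>.\<close>
    using that[where p = 1 and q = 0 and s = 0 and t = 1]
      that[where p = 0 and q = 1 and s = "-1" and t = 0] by auto
next
  case False
  then obtain d where d: "is_gcd_of d a b"
    using ex_gcd by blast
  with False obtain x y where xy: "d = x * a + y * b"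
    using gcd_lincomb by blast
  from d obtain a' b' where a': "a = d * a'" and b': "b = d * b'"
    by (auto simp: is_gcd_of_def elim!: dvdE)
  have "d \<noteq> 0"
    using False a' by auto
  moreover have "d * (x * a' + y * b') = d * 1"
    using xy a' b' by (simp add: algebra_simps)
  ultimately have "x * a' + y * b' = 1"
    by (metis mult_left_cancel)
  then have "x * a' - y * (- b') = 1"
    by simp
  moreover have "- b' * a + a' * b = 0"
    by (simp add: a' b' algebra_simps)
  ultimately show ?thesis
    using that xy by metis
qed

text \<open>The inverse is an explicit witness \<open>V\<close>, so the choice operator behind
  \<open>matrix_inv\<close> enters only at the very end, through
  \<open>matrix_inv_eqI\<close>.\<close>

definition similar_matrix :: "'a::semiring_1 ^ 'n ^ 'n \<Rightarrow> 'a ^ 'n ^ 'n \<Rightarrow> bool" where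
  "similar_matrix A B \<longleftrightarrow> (\<exists>U V. U ** V = mat 1 \<and> V ** U = mat 1 \<and> V ** A ** U = B)"

lemma similar_matrixI:
  "U ** V = mat 1 \<Longrightarrow> V ** U = mat 1 \<Longrightarrow> V ** A ** U = B \<Longrightarrow> similar_matrix A B"
  by (auto simp: similar_matrix_def)

lemma similar_matrix_refl: "similar_matrix A A"
  by (rule similar_matrixI[of "mat 1" "mat 1"]) simp_all

lemma similar_matrix_trans [trans]:
  assumes "similar_matrix A B" "similar_matrix B C"
  shows "similar_matrix A C"
proof -
  obtain U V U' V' where UV: "U ** V = mat 1" "V ** U = mat 1" "V ** A ** U = B"
    and UV': "U' ** V' = mat 1" "V' ** U' = mat 1" "V' ** B ** U' = C"
    using assms by (auto simp: similar_matrix_def)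
  show ?thesis
  proof (rule similar_matrixI)
    show "(U ** U') ** (V' ** V) = mat 1"
      by (metis UV(1) UV'(1) matrix_mul_assoc matrix_mul_rid)
    show "(V' ** V) ** (U ** U') = mat 1"
      by (metis UV(2) UV'(2) matrix_mul_assoc matrix_mul_rid)
    show "(V' ** V) ** A ** (U ** U') = C"
      by (metis UV(3) UV'(3) matrix_mul_assoc)
  qed
qed

lemma similar_matrix_square_zero:
  assumes "similar_matrix A B" "A ** A = 0"
  shows "B ** B = 0"
proof -
  obtain U V where UV: "U ** V = mat 1" "V ** A ** U = B"
    using assms(1) by (auto simp: similar_matrix_def)
  have "B ** B = V ** A ** (U ** V) ** A ** U"
    by (simp add: UV(2)[symmetric] matrix_mul_assoc)
  also have "\<dots> = V ** (A ** A) ** U"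
    by (simp add: UV(1) matrix_mul_assoc)
  also have "\<dots> = 0"
    unfolding assms(2) by (simp add: matrix_matrix_mult_def vec_eq_iff)
  finally show ?thesis .
qed

lemma matrix_inv_eqI:
  assumes "U ** V = mat 1" "V ** U = mat 1"
  shows "matrix_inv U = V"
proof -
  have "U ** matrix_inv U = mat 1 \<and> matrix_inv U ** U = mat 1"
    unfolding matrix_inv_def by (rule someI[of _ V]) (use assms in simp)
  then show ?thesis
    by (metis assms(2) matrix_mul_assoc matrix_mul_lid matrix_mul_rid)
qed

definition mat3 :: "'a \<Rightarrow> 'a \<Rightarrow> 'a \<Rightarrow> 'a \<Rightarrow> 'a \<Rightarrow> 'a \<Rightarrow> 'a \<Rightarrow> 'a \<Rightarrow> 'a \<Rightarrow> 'a::zero ^ 3 ^ 3" where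
  "mat3 a b c d e f g h i = vector [vector [a, b, c], vector [d, e, f], vector [g, h, i]]"

lemma mat3_cases:
  fixes A :: "'a::zero ^ 3 ^ 3"
  obtains a b c d e f g h i where "A = mat3 a b c d e f g h i"
proof
  show "A = mat3 (A$1$1) (A$1$2) (A$1$3) (A$2$1) (A$2$2) (A$2$3) (A$3$1) (A$3$2) (A$3$3)"
    by (simp add: mat3_def vec_eq_iff forall_3)
qed

lemma mat3_eq_iff:
  "mat3 a b c d e f g h i = mat3 a' b' c' d' e' f' g' h' i' \<longleftrightarrow>
    a = a' \<and> b = b' \<and> c = c' \<and> d = d' \<and> e = e' \<and> f = f' \<and> g = g' \<and> h = h' \<and> i = i'"
  by (auto simp: mat3_def vec_eq_iff forall_3)

lemma mat3_mult:
  "mat3 a b c d e f g h i ** mat3 a' b' c' d' e' f' g' h' i' =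
    mat3 (a*a' + b*d' + c*g') (a*b' + b*e' + c*h') (a*c' + b*f' + c*i')
         (d*a' + e*d' + f*g') (d*b' + e*e' + f*h') (d*c' + e*f' + f*i')
         (g*a' + h*d' + i*g') (g*b' + h*e' + i*h') (g*c' + h*f' + i*(i'::'a::semiring_1))"
  by (simp add: mat3_def vec_eq_iff forall_3 matrix_matrix_mult_def sum_3)

lemma mat3_mult_vector:
  "mat3 a b c d e f g h i *v vector [x, y, z] =
    vector [a*x + b*y + c*z, d*x + e*y + f*z, g*x + h*y + i*(z::'a::semiring_1)]"
  by (simp add: mat3_def vec_eq_iff forall_3 matrix_vector_mult_def sum_3)

lemma vector3_eq_0_iff: "vector [x, y, z] = (0 :: 'a::zero ^ 3) \<longleftrightarrow> x = 0 \<and> y = 0 \<and> z = 0"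
  by (simp add: vec_eq_iff forall_3)

lemma mat3_one: "mat 1 = mat3 1 0 0 0 1 0 0 0 (1::'a::semiring_1)"
  by (simp add: mat3_def vec_eq_iff forall_3 mat_def)

lemma mat3_zero: "0 = mat3 0 0 0 0 0 0 0 0 0"
  by (simp add: mat3_def vec_eq_iff forall_3)

lemma mat3_E13: "map_matrix ((*) r) E13 = mat3 0 0 r 0 0 0 0 0 (0::'a::semiring_1)"
  by (simp add: mat3_def vec_eq_iff forall_3 E13_def map_matrix_def)

lemma conj_block12:
  fixes p :: "'a::comm_ring_1"
  assumes "p * t - q * s = 1"
  shows "similar_matrix A (mat3 p q 0 s t 0 0 0 1 ** A ** mat3 t (-q) 0 (-s) p 0 0 0 1)"
  using assms by (intro similar_matrixI) (auto simp: mat3_mult mat3_one mat3_eq_iff algebra_simps)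

lemma conj_block23:
  fixes p :: "'a::comm_ring_1"
  assumes "p * t - q * s = 1"
  shows "similar_matrix A (mat3 1 0 0 0 p q 0 s t ** A ** mat3 1 0 0 0 t (-q) 0 (-s) p)"
  using assms by (intro similar_matrixI) (auto simp: mat3_mult mat3_one mat3_eq_iff algebra_simps)

lemma kernel_block12:
  fixes A :: "'a::bezout_domain ^ 3 ^ 3"
  assumes "A *v vector [x, y, z] = 0"
  obtains B g where "similar_matrix A B" "B *v vector [g, 0, z] = 0" "x = 0 \<and> y = 0 \<longleftrightarrow> g = 0"
proof -
  obtain p q s t g where h: "p * t - q * s = 1" "p * x + q * y = g" "s * x + t * y = 0"
    by (rule bezout_unimodular)
  let ?V = "mat3 p q 0 s t 0 0 0 1" and ?U = "mat3 t (-q) 0 (-s) p 0 0 0 1"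
  \<comment> \<open>Apply the adjugate of the block to \<open>(g, 0)\<close>.\<close>
  have x: "x = t * g" and y: "y = - s * g"
    using h by algebra+
  have "?U *v vector [g, 0, z] = vector [x, y, z]"
    by (simp add: x y mat3_def vec_eq_iff forall_3 matrix_vector_mult_def sum_3)
  then have "(?V ** A ** ?U) *v vector [g, 0, z] = 0"
    by (metis assms matrix_vector_mul_assoc matrix_vector_mult_0_right)
  moreover have "x = 0 \<and> y = 0 \<longleftrightarrow> g = 0"
    using h(2) x y by auto
  ultimately show ?thesis
    using conj_block12[OF h(1)] that by blast
qed

text \<open>The conjugate is displayed rather than hidden behind an existential, because its shape
  is needed later: conjugation by this block keeps a zero first column zero.\<close>

lemma kernel_block23:
  fixes A :: "'a::bezout_domain ^ 3 ^ 3"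
  assumes "A *v vector [x, y, z] = 0"
  obtains p q s t g where "p * t - q * s = 1" "y = 0 \<and> z = 0 \<longleftrightarrow> g = 0"
    "(mat3 1 0 0 0 p q 0 s t ** A ** mat3 1 0 0 0 t (-q) 0 (-s) p) *v vector [x, g, 0] = 0"
proof -
  obtain p q s t g where h: "p * t - q * s = 1" "p * y + q * z = g" "s * y + t * z = 0"
    by (rule bezout_unimodular)
  let ?V = "mat3 1 0 0 0 p q 0 s t" and ?U = "mat3 1 0 0 0 t (-q) 0 (-s) p"
  have y: "y = t * g" and z: "z = - s * g"
    using h by algebra+
  have "?U *v vector [x, g, 0] = vector [x, y, z]"
    by (simp add: y z mat3_def vec_eq_iff forall_3 matrix_vector_mult_def sum_3)
  then have "(?V ** A ** ?U) *v vector [x, g, 0] = 0"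
    by (metis assms matrix_vector_mul_assoc matrix_vector_mult_0_right)
  moreover have "y = 0 \<and> z = 0 \<longleftrightarrow> g = 0"
    using h(2) y z by auto
  ultimately show ?thesis
    using h(1) that by blast
qed

lemma square_zero_first_column:
  fixes T :: "'a::bezout_domain ^ 3 ^ 3"
  assumes "T ** T = 0"
  obtains a b c d e f where "similar_matrix T (mat3 0 a b 0 c d 0 e f)"
proof (cases "T = 0")
  case True
  then show ?thesis
    using that similar_matrix_refl mat3_zero by metis
next
  case False
  then obtain x y z where v: "T *v vector [x, y, z] = 0" "\<not> (x = 0 \<and> y = 0 \<and> z = 0)"
  proof -
    obtain i j where ij: "T $ i $ j \<noteq> 0"
      using False by (auto simp: vec_eq_iff)
    have "T *v vector [T$1$j, T$2$j, T$3$j] = column j (T ** T)"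
      by (simp add: vec_eq_iff forall_3 column_def matrix_vector_mult_def matrix_matrix_mult_def sum_3)
    also have "\<dots> = 0"
      by (simp add: assms column_def vec_eq_iff)
    finally have "T *v vector [T$1$j, T$2$j, T$3$j] = 0" .
    moreover have "\<not> (T$1$j = 0 \<and> T$2$j = 0 \<and> T$3$j = 0)"
      using ij exhaust_3[of i] by auto
    ultimately show thesis
      by (rule that)
  qed
  \<comment> \<open>Clear the third coordinate of the kernel vector first, then the second; the
    equivalences with \<open>g = 0\<close> and \<open>k = 0\<close> ensure that the vector stays
    nonzero.\<close>
  from v(1) obtain p q s t g where h: "p * t - q * s = 1" "y = 0 \<and> z = 0 \<longleftrightarrow> g = 0"
    "(mat3 1 0 0 0 p q 0 s t ** T ** mat3 1 0 0 0 t (-q) 0 (-s) p) *v vector [x, g, 0] = 0"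
    by (rule kernel_block23)
  from h(3) obtain B k where B: "similar_matrix
      (mat3 1 0 0 0 p q 0 s t ** T ** mat3 1 0 0 0 t (-q) 0 (-s) p) B"
    "B *v vector [k, 0, 0] = 0" "x = 0 \<and> g = 0 \<longleftrightarrow> k = 0"
    by (rule kernel_block12)
  have "k \<noteq> 0"
    using v(2) h(2) B(3) by auto
  have "similar_matrix T B"
    using conj_block23[OF h(1)] B(1) by (rule similar_matrix_trans)
  moreover obtain a1 a2 a3 b1 b2 b3 c1 c2 c3 where B': "B = mat3 a1 a2 a3 b1 b2 b3 c1 c2 c3"
    by (rule mat3_cases)
  \<comment> \<open>The kernel vector yields \<open>k\<close> times the first column equal to 0, and
    there are no zero divisors.\<close>
  moreover have "a1 = 0 \<and> b1 = 0 \<and> c1 = 0"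
    using B(2) \<open>k \<noteq> 0\<close> by (simp add: B' mat3_mult_vector vector3_eq_0_iff)
  ultimately show ?thesis
    using that by blast
qed

lemma square_zero_third_column_or_first_row:
  fixes a :: "'a::bezout_domain"
  assumes sq: "mat3 0 a b 0 c d 0 e f ** mat3 0 a b 0 c d 0 e f = 0"
  obtains x y where "similar_matrix (mat3 0 a b 0 c d 0 e f) (mat3 0 0 x 0 0 y 0 0 0)
    \<or> similar_matrix (mat3 0 a b 0 c d 0 e f) (mat3 0 x y 0 0 0 0 0 0)"
proof (cases "c = 0 \<and> e = 0")
  case True
  \<comment> \<open>The third column of the square now contains \<open>f * f\<close> and
    \<open>a * d + b * f\<close>. Here \<open>a = 0\<close> leaves only the third column,
    \<open>d = 0\<close> only the first row.\<close>
  then have "f = 0" "a = 0 \<or> d = 0"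
    using sq by (auto simp: mat3_mult mat3_zero mat3_eq_iff)
  with True that show ?thesis
    using similar_matrix_refl by metis
next
  case False
  let ?T = "mat3 0 a b 0 c d 0 e f"
  \<comment> \<open>This is the second column of the square of \<open>?T\<close>.\<close>
  have "?T *v vector [a, c, e] = 0"
    using sq by (simp add: mat3_mult mat3_zero mat3_eq_iff mat3_mult_vector vector3_eq_0_iff)
  then obtain p q s t g where h: "p * t - q * s = 1" "c = 0 \<and> e = 0 \<longleftrightarrow> g = 0"
    "(mat3 1 0 0 0 p q 0 s t ** ?T ** mat3 1 0 0 0 t (-q) 0 (-s) p) *v vector [a, g, 0] = 0"
    by (rule kernel_block23)
  let ?B = "mat3 1 0 0 0 p q 0 s t ** ?T ** mat3 1 0 0 0 t (-q) 0 (-s) p"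
  have "g \<noteq> 0"
    using h(2) False by simp
  obtain a1 a2 a3 b1 b2 b3 c1 c2 c3 where B: "?B = mat3 a1 a2 a3 b1 b2 b3 c1 c2 c3"
    by (rule mat3_cases)
  then have first: "a1 = 0" "b1 = 0" "c1 = 0"
    by (auto simp: mat3_mult mat3_eq_iff)
  \<comment> \<open>Since the first column vanishes, the entry \<open>a\<close> of the kernel vector
    contributes nothing: what remains is \<open>g\<close> times the second column.\<close>
  with h(3) \<open>g \<noteq> 0\<close> have second: "a2 = 0" "b2 = 0" "c2 = 0"
    unfolding B by (auto simp: mat3_mult_vector vector3_eq_0_iff)
  have sim: "similar_matrix ?T ?B"
    by (rule conj_block23[OF h(1)])
  from similar_matrix_square_zero[OF this sq] have "c3 = 0"
    \<comment> \<open>The last diagonal entry of the square is \<open>c3 * c3\<close>.\<close>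
    unfolding B by (simp add: first second mat3_mult mat3_zero mat3_eq_iff)
  with sim have "similar_matrix ?T (mat3 0 0 a3 0 0 b3 0 0 0)"
    by (simp add: B first second)
  then show ?thesis
    using that by blast
qed

text \<open>The left factor takes \<open>(x, y)\<close> to \<open>(g, 0)\<close> in the third
  column, while the right factor fixes that column; hence \<open>r = g\<close>.\<close>

lemma third_column_similar_E13:
  fixes x :: "'a::bezout_domain"
  obtains r where "similar_matrix (mat3 0 0 x 0 0 y 0 0 0) (map_matrix ((*) r) E13)"
proof -
  obtain p q s t g where h: "p * t - q * s = 1" "p * x + q * y = g" "s * x + t * y = 0"
    by (rule bezout_unimodular)
  show ?thesis
    using conj_block12[OF h(1), of "mat3 0 0 x 0 0 y 0 0 0"] h that
    by (simp add: mat3_mult mat3_E13)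
qed

lemma first_row_similar_E13:
  fixes x :: "'a::bezout_domain"
  obtains r where "similar_matrix (mat3 0 x y 0 0 0 0 0 0) (map_matrix ((*) r) E13)"
proof -
  \<comment> \<open>The row \<open>(x, y)\<close> is multiplied by the inverse block from the right
    and must become \<open>(0, g)\<close>. Hence the pair is swapped here, and \<open>q\<close> and
    \<open>s\<close> change sign in \<open>det\<close>.\<close>
  obtain p q s t g where h: "p * t - q * s = 1" "p * y + q * x = g" "s * y + t * x = 0"
    by (rule bezout_unimodular)
  have eq: "x * t + y * s = 0" "x * q + y * p = g"
    using h by (simp_all add: algebra_simps)
  have det: "p * t - (- q) * (- s) = 1"
    using h(1) by simp
  show ?thesis
    using conj_block23[OF det, of "mat3 0 x y 0 0 0 0 0 0"] eq that
    by (simp add: mat3_mult mat3_E13)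
qed

theorem theorem3p5:
  fixes T :: "'a::bezout_domain ^ 3 ^ 3"
  assumes "T ** T = 0"
  shows "\<exists>(r::'a) (U::'a ^ 3 ^ 3). invertible U \<and> matrix_inv U ** T ** U = map_matrix ((*) r) E13"
proof -
  obtain a b c d e f where 1: "similar_matrix T (mat3 0 a b 0 c d 0 e f)"
    using assms by (rule square_zero_first_column)
  obtain x y where "similar_matrix (mat3 0 a b 0 c d 0 e f) (mat3 0 0 x 0 0 y 0 0 0)
    \<or> similar_matrix (mat3 0 a b 0 c d 0 e f) (mat3 0 x y 0 0 0 0 0 0)"
    using similar_matrix_square_zero[OF 1 assms]
    by (rule square_zero_third_column_or_first_row)
  then obtain r where "similar_matrix T (map_matrix ((*) r) E13)"
    using 1 third_column_similar_E13 first_row_similar_E13 similar_matrix_trans by metis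
  then obtain U V where "U ** V = mat 1" "V ** U = mat 1" "V ** T ** U = map_matrix ((*) r) E13"
    by (auto simp: similar_matrix_def)
  then show ?thesis
    using matrix_inv_eqI invertible_def by metis
qed

end
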